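(* Let $S\in\mathrm{Sp}_+(d,\mathbb{C})$ have $d\times d$ blocks $S=\begin{pmatrix}A&B\\C&D\end{pmatrix}$, and let $\widehat S\in\mathrm{Mp}_+(d,\mathbb{C})$ have projection $\pi^{Mp}_+(\widehat S)=S$. Let $$\widetilde S=\begin{pmatrix}\overline A&-\overline B\\-\overline C&\overline D\end{pmatrix}.$$ Then the operator $T$ defined by $Tf=\overline{\widehat S\,\overline f}$, $f\in L^2(\mathbb{R}^d)$, is in $\mathrm{Mp}_+(d,\mathbb{C})$ and $\pi^{Mp}_+(T)=\widetilde S$.
   Context: Let $J=\begin{pmatrix}O_d&I_d\\-I_d&O_d\end{pmatrix}$, $V_Q=\begin{pmatrix}I_d&O_d\\Q&I_d\end{pmatrix}$, $\mathcal{D}_E=\begin{pmatrix}E^{-1}&O_d\\O_d&E^\top\end{pmatrix}$. $\mathrm{Sp}(d,\mathbb{C})=\{S:S^\top JS=J\}$, and $\mathrm{Sp}_+(d,\mathbb{C})$ is the semigroup of those $S$ with $i^{-1}(\sigma(Sz,\overline{Sz})-\sigma(z,\overline z))\ge0$ for all $z\in\mathbb{C}^{2d}$, $\sigma(z,w)=Jz\cdot w$ (bilinear dot product). With $\widehat f(\eta)=\int f(x)e^{-2\pi i\eta\cdot x}dx$, $\mathrm{Mp}(d,\mathbb{R})$ is the group of unitary operators on $L^2(\mathbb{R}^d)$ generated by $\mathcal{F}f=i^{-d/2}\widehat f$, $\mathfrak{p}_Qf(x)=e^{i\pi Qx\cdot x}f(x)$ ($Q$ real symmetric), $\mathfrak{T}_Ef(x)=i^m|\det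 E|^{1/2}f(Ex)$ ($E\in\mathrm{GL}(d,\mathbb{R})$, $m\in\mathbb{Z}$ with $m\pi$ an argument of $\det E$); the two-fold covering homomorphism $\pi^{Mp}$ onto $\mathrm{Sp}(d,\mathbb{R})$ sends these to $J,V_Q,\mathcal{D}_E$. For $\vartheta\ge0$, $\alpha>0$ set on $L^2(\mathbb{R})$: $\mathfrak{R}_\vartheta f(x)=(\cosh\vartheta)^{-1/2}\int_{\mathbb{R}}e^{i\pi(2x\eta+i(x^2+\eta^2)\sinh\vartheta)/\cosh\vartheta}\widehat f(\eta)d\eta$, $\mathfrak{p}_{i\alpha}f(x)=e^{-\pi\alpha x^2}f(x)$. An atomic metaplectic contraction is $\widehat\Xi=\widehat\Xi_1\otimes\cdots\otimes\widehat\Xi_d$ with each $\widehat\Xi_j$ equal to some $\mathfrak{R}_{\vartheta_j}$ or $\mathfrak{p}_{i\alpha_j}$. $\mathrm{Mp}_+(d,\mathbb{C})$ is the semigroup generated by $\mathrm{Mp}(d,\mathbb{R})$ and atomic metaplectic contractions. The projection is the homomorphism $\pi^{Mp}_+:\mathrm{Mp}_+(d,\mathbb{C})\to\mathrm{Sp}_+(d,\mathbb{C})$ (a two-fold cover) equal to $\pi^{Mp}$ on $\mathrm{Mp}(d,\mathbb{R})$ and sending $\widehat\Xi$ to $\Xi=\begin{pmatrix}\mathrm{diag}(a_j)&\mathrm{diag}(b_j)\\ \mathrm{diag}(c_j)&\mathrm{diag}(d_j)\end{pmatrix}$, where $\begin{pmatrix}a_j&b_j\\c_j&d_j\end{pmatrix}$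 is $\begin{pmatrix}\cosh\vartheta_j&-i\sinh\vartheta_j\\ i\sinh\vartheta_j&\cosh\vartheta_j\end{pmatrix}$ if $\widehat\Xi_j=\mathfrak{R}_{\vartheta_j}$ and $\begin{pmatrix}1&0\\ i\alpha_j&1\end{pmatrix}$ if $\widehat\Xi_j=\mathfrak{p}_{i\alpha_j}$. *)

theory Defs
  imports "HOL-Analysis.Analysis"
begin

section \<open>The Hilbert space of square-integrable functions\<close>

definition square_integrable :: "('a::euclidean_space \<Rightarrow> complex) \<Rightarrow> bool" where
  "square_integrable f \<longleftrightarrow>
     f \<in> borel_measurable lborel \<and> integrable lborel (\<lambda>x. (cmod (f x))\<^sup>2)"

lemma borel_measurable_cnj:
  "f \<in> borel_measurable M \<Longrightarrow> (\<lambda>x. cnj (f x)) \<in> borel_measurable M"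
  by (rule measurable_compose[OF _ borel_measurable_continuous_onI])
     (auto intro: continuous_on_cnj continuous_on_id)

lemma square_integrable_mult:
  assumes "square_integrable f" "square_integrable g"
  shows "integrable lborel (\<lambda>x. f x * cnj (g x))"
proof (rule Bochner_Integration.integrable_bound)
  show "integrable lborel (\<lambda>x. (cmod (f x))\<^sup>2 + (cmod (g x))\<^sup>2)"
    using assms by (simp add: square_integrable_def)
  show "(\<lambda>x. f x * cnj (g x)) \<in> borel_measurable lborel"
    using assms by (auto simp: square_integrable_def intro!: borel_measurable_times borel_measurable_cnj)
  have "a * b \<le> a\<^sup>2 + b\<^sup>2" if "a \<ge> 0" "b \<ge> 0" for a b :: real
    using sum_squares_bound[of a b] that mult_nonneg_nonneg[of a b] by linarith
  then show "AE x in lborel. norm (f x * cnj (g x)) \<le> norm ((cmod (f x))\<^sup>2 + (cmod (g x))\<^sup>2)"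
    by (simp add: norm_mult)
qed

lemma square_integrable_add:
  assumes "square_integrable f" "square_integrable g"
  shows "square_integrable (\<lambda>x. f x + g x)"
  unfolding square_integrable_def
proof
  show meas: "(\<lambda>x. f x + g x) \<in> borel_measurable lborel"
    using assms by (auto simp: square_integrable_def)
  show "integrable lborel (\<lambda>x. (cmod (f x + g x))\<^sup>2)"
  proof (rule Bochner_Integration.integrable_bound)
    show "integrable lborel (\<lambda>x. 2 * (cmod (f x))\<^sup>2 + 2 * (cmod (g x))\<^sup>2)"
      using assms by (simp add: square_integrable_def)
    show "(\<lambda>x. (cmod (f x + g x))\<^sup>2) \<in> borel_measurable lborel"
      using meas by measurable
    have "(cmod (a + b))\<^sup>2 \<le> 2 * (cmod a)\<^sup>2 + 2 * (cmod b)\<^sup>2" for a b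
    proof -
      have "(cmod (a + b))\<^sup>2 \<le> (cmod a + cmod b)\<^sup>2"
        by (intro power_mono norm_triangle_ineq) auto
      then show ?thesis
        using sum_squares_bound[of "cmod a" "cmod b"] by (simp add: power2_sum)
    qed
    then show "AE x in lborel. norm ((cmod (f x + g x))\<^sup>2) \<le>
        norm (2 * (cmod (f x))\<^sup>2 + 2 * (cmod (g x))\<^sup>2)"
      by simp
  qed
qed

lemma square_integrable_cmult:
  "square_integrable f \<Longrightarrow> square_integrable (\<lambda>x. c * f x)"
  by (auto simp: square_integrable_def norm_mult power_mult_distrib)

lemma square_integrable_zero: "square_integrable (\<lambda>x. 0)"
  by (simp add: square_integrable_def)

definition L2_rel :: "('a::euclidean_space \<Rightarrow> complex) \<Rightarrow> ('a \<Rightarrow> complex) \<Rightarrow> bool" where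
  "L2_rel f g \<longleftrightarrow>
     square_integrable f \<and> square_integrable g \<and> (AE x in lborel. f x = g x)"

quotient_type (overloaded) 'a L2 = "'a::euclidean_space \<Rightarrow> complex" / partial: L2_rel
proof (rule part_equivpI)
  show "\<exists>x :: 'a \<Rightarrow> complex. L2_rel x x"
    using square_integrable_zero by (auto simp: L2_rel_def)
  show "symp (L2_rel :: ('a \<Rightarrow> complex) \<Rightarrow> _)"
    by (auto simp: L2_rel_def symp_def elim: AE_mp)
  show "transp (L2_rel :: ('a \<Rightarrow> complex) \<Rightarrow> _)"
  proof (rule transpI)
    fix f g h :: "'a \<Rightarrow> complex"
    assume "L2_rel f g" "L2_rel g h"
    then show "L2_rel f h"
      unfolding L2_rel_def by (auto elim: AE_mp)
  qed
qed

instantiation L2 :: (euclidean_space) real_vector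
begin

lift_definition zero_L2 :: "'a L2" is "\<lambda>x. 0"
  by (simp add: L2_rel_def square_integrable_zero)

lift_definition plus_L2 :: "'a L2 \<Rightarrow> 'a L2 \<Rightarrow> 'a L2" is "\<lambda>f g x. f x + g x"
  unfolding L2_rel_def by (auto intro: square_integrable_add elim: AE_mp)

lift_definition scaleR_L2 :: "real \<Rightarrow> 'a L2 \<Rightarrow> 'a L2" is "\<lambda>r f x. of_real r * f x"
  unfolding L2_rel_def by (auto intro: square_integrable_cmult elim: AE_mp)

lift_definition uminus_L2 :: "'a L2 \<Rightarrow> 'a L2" is "\<lambda>f x. - 1 * f x"
  unfolding L2_rel_def by (auto intro: square_integrable_cmult[of _ "-1", simplified] elim: AE_mp)

definition minus_L2 :: "'a L2 \<Rightarrow> 'a L2 \<Rightarrow> 'a L2" where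
  "minus_L2 f g = f + - g"

instance
proof
  fix f g h :: "'a L2" and a b :: real
  show "f + g + h = f + (g + h)"
    by transfer (auto simp: L2_rel_def add.assoc intro!: square_integrable_add)
  show "f + g = g + f"
    by transfer (auto simp: L2_rel_def add.commute intro!: square_integrable_add)
  show "0 + f = f"
    by transfer (auto simp: L2_rel_def)
  show "- f + f = 0"
    by transfer (auto simp: L2_rel_def square_integrable_zero)
  show "f - g = f + - g"
    by (simp add: minus_L2_def)
  show "a *\<^sub>R (f + g) = a *\<^sub>R f + a *\<^sub>R g"
    by transfer (auto simp: L2_rel_def distrib_left
        intro!: square_integrable_add square_integrable_cmult)
  show "(a + b) *\<^sub>R f = a *\<^sub>R f + b *\<^sub>R f"
    by transfer (auto simp: L2_rel_def distrib_right
        intro!: square_integrable_add square_integrable_cmult)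
  show "a *\<^sub>R b *\<^sub>R f = (a * b) *\<^sub>R f"
    by transfer (auto simp: L2_rel_def mult.assoc intro!: square_integrable_cmult)
  show "1 *\<^sub>R f = f"
    by transfer (auto simp: L2_rel_def)
qed

end

instantiation L2 :: (euclidean_space) real_inner
begin

lift_definition inner_L2 :: "'a L2 \<Rightarrow> 'a L2 \<Rightarrow> real"
  is "\<lambda>f g. Re (LINT x|lborel. f x * cnj (g x))"
proof -
  fix f f' g g' :: "'a \<Rightarrow> complex"
  assume *: "L2_rel f f'" "L2_rel g g'"
  have "(LINT x|lborel. f x * cnj (g x)) = (LINT x|lborel. f' x * cnj (g' x))"
  proof (rule integral_cong_AE)
    show "AE x in lborel. f x * cnj (g x) = f' x * cnj (g' x)"
      using * by (auto simp: L2_rel_def elim: AE_mp)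
  qed (use * in \<open>auto simp: L2_rel_def square_integrable_def
        intro!: borel_measurable_times borel_measurable_cnj\<close>)
  then show "Re (LINT x|lborel. f x * cnj (g x)) = Re (LINT x|lborel. f' x * cnj (g' x))"
    by simp
qed

definition norm_L2 :: "'a L2 \<Rightarrow> real" where
  "norm_L2 f = sqrt (inner f f)"

definition dist_L2 :: "'a L2 \<Rightarrow> 'a L2 \<Rightarrow> real" where
  "dist_L2 f g = norm (f - g)"

definition sgn_L2 :: "'a L2 \<Rightarrow> 'a L2" where
  "sgn_L2 f = f /\<^sub>R norm f"

definition uniformity_L2 :: "('a L2 \<times> 'a L2) filter" where
  "uniformity_L2 = (INF e\<in>{0<..}. principal {(f, g). dist f g < e})"

definition open_L2 :: "'a L2 set \<Rightarrow> bool" where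
  "open_L2 U \<longleftrightarrow> (\<forall>f\<in>U. eventually (\<lambda>(f', g). f' = f \<longrightarrow> g \<in> U) uniformity)"

instance
proof
  fix f g h :: "'a L2" and r :: real and U :: "'a L2 set"
  show "dist f g = norm (f - g)"
    by (simp add: dist_L2_def)
  show "sgn f = f /\<^sub>R norm f"
    by (simp add: sgn_L2_def)
  show "uniformity = (INF e\<in>{0<..}. principal {(f, g :: 'a L2). dist f g < e})"
    by (simp add: uniformity_L2_def)
  show "open U \<longleftrightarrow> (\<forall>f\<in>U. eventually (\<lambda>(f', g). f' = f \<longrightarrow> g \<in> U) uniformity)"
    by (simp add: open_L2_def)
  show "norm f = sqrt (inner f f)"
    by (simp add: norm_L2_def)
  show "inner f g = inner g f"
  proof transfer
    fix f g :: "'a \<Rightarrow> complex"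
    have "(LINT x|lborel. f x * cnj (g x)) = cnj (LINT x|lborel. g x * cnj (f x))"
      by (simp add: Bochner_Integration.integral_cnj[symmetric] mult.commute del: Bochner_Integration.integral_cnj)
    then show "Re (LINT x|lborel. f x * cnj (g x)) = Re (LINT x|lborel. g x * cnj (f x))"
      by simp
  qed
  show "inner (f + g) h = inner f h + inner g h"
    by transfer (auto simp: L2_rel_def distrib_right Bochner_Integration.integral_add
        square_integrable_mult)
  show "inner (r *\<^sub>R f) g = r * inner f g"
    by transfer (simp add: mult.assoc)
  have *: "Re (LINT x|lborel. f x * cnj (f x)) = (LINT x|lborel. (cmod (f x))\<^sup>2)"
    for f :: "'a \<Rightarrow> complex"
    by (simp only: complex_norm_square[symmetric] integral_complex_of_real Re_complex_of_real)
  show "0 \<le> inner f f"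
    by transfer (simp only: *, simp)
  show "inner f f = 0 \<longleftrightarrow> f = 0"
  proof transfer
    fix f :: "'a \<Rightarrow> complex"
    assume "L2_rel f f"
    then show "(Re (LINT x|lborel. f x * cnj (f x)) = 0) = L2_rel f (\<lambda>x. 0)"
      unfolding *
      by (subst integral_nonneg_eq_0_iff_AE)
         (auto simp: L2_rel_def square_integrable_zero square_integrable_def)
  qed
qed

end

text \<open>
  \<open>L2_of f\<close> is the class of a square-integrable function \<open>f\<close> (and, by convention, 0 if
  \<open>f\<close> is not square-integrable); \<open>rep_L2 f\<close> is an arbitrary representative. Below, the
  results never depend on the choice of the representative.
\<close>

definition L2_of :: "('a::euclidean_space \<Rightarrow> complex) \<Rightarrow> 'a L2" where
  "L2_of f = (if square_integrable f then abs_L2 f else 0)"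

definition cscale_L2 :: "complex \<Rightarrow> 'a::euclidean_space L2 \<Rightarrow> 'a L2" where
  "cscale_L2 c f = L2_of (\<lambda>x. c * rep_L2 f x)"

definition cnj_L2 :: "'a::euclidean_space L2 \<Rightarrow> 'a L2" where
  "cnj_L2 f = L2_of (\<lambda>x. cnj (rep_L2 f x))"

text \<open>
  \<open>integral_op K f\<close> is the function \<open>y \<mapsto> \<integral> K y x * f x dx\<close>, where the integral is understood as the
  limit in the mean of the integrals over the balls of radius \<open>n\<close>. This is needed because
  for the kernels below, of the Fourier transform and of the operators $\mathfrak{R}_\vartheta$
  including $\vartheta = 0$, the integral need not converge absolutely. For these kernels the limit
  exists for every \<open>f\<close> (by Plancherel's theorem), and it is the pointwise integral whenever that
  converges absolutely; the value 0 in the divergent case only makes the definition total.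
\<close>

definition truncated_integral_op ::
  "('a::euclidean_space \<Rightarrow> 'a \<Rightarrow> complex) \<Rightarrow> 'a L2 \<Rightarrow> nat \<Rightarrow> 'a L2" where
  "truncated_integral_op K f n =
     L2_of (\<lambda>y. LINT x:cball 0 (real n)|lborel. K y x * rep_L2 f x)"

definition integral_op :: "('a::euclidean_space \<Rightarrow> 'a \<Rightarrow> complex) \<Rightarrow> 'a L2 \<Rightarrow> 'a L2" where
  "integral_op K f =
     (if convergent (truncated_integral_op K f) then lim (truncated_integral_op K f) else 0)"

definition fourier_L2 :: "'a::euclidean_space L2 \<Rightarrow> 'a L2" where
  "fourier_L2 = integral_op (\<lambda>\<eta> x. exp (- 2 * pi * \<i> * of_real (\<eta> \<bullet> x)))"


section \<open>Complex symplectic matrices\<close>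

text \<open>
  Matrices of size \<open>2d\<close>, \<open>d = CARD('n)\<close>, have the index type \<open>'n + 'n\<close>: \<open>Inl\<close> indexes the first
  \<open>d\<close> coordinates and \<open>Inr\<close> the last \<open>d\<close> ones.
\<close>

definition block_mat ::
  "'a^'n^'n \<Rightarrow> 'a^'n^'n \<Rightarrow> 'a^'n^'n \<Rightarrow> 'a^'n^'n \<Rightarrow> 'a^('n + 'n)^('n::finite + 'n)" where
  "block_mat A B C D = (\<chi> i j. case i of
       Inl k \<Rightarrow> (case j of Inl l \<Rightarrow> A $ k $ l | Inr l \<Rightarrow> B $ k $ l)
     | Inr k \<Rightarrow> (case j of Inl l \<Rightarrow> C $ k $ l | Inr l \<Rightarrow> D $ k $ l))"

definition diag_mat :: "('n \<Rightarrow> 'a::zero) \<Rightarrow> 'a^'n^'n::finite" where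
  "diag_mat a = (\<chi> i j. if i = j then a i else 0)"

definition J_mat :: "complex^('n + 'n)^('n::finite + 'n)" where
  "J_mat = block_mat 0 (mat 1) (- mat 1) 0"

definition V_mat :: "real^'n^'n \<Rightarrow> complex^('n + 'n)^('n::finite + 'n)" where
  "V_mat Q = block_mat (mat 1) 0 (map_matrix complex_of_real Q) (mat 1)"

definition D_mat :: "real^'n^'n \<Rightarrow> complex^('n + 'n)^('n::finite + 'n)" where
  "D_mat E = block_mat (map_matrix complex_of_real (matrix_inv E)) 0
                       0 (map_matrix complex_of_real (transpose E))"

definition Sp_complex :: "(complex^('n + 'n)^('n::finite + 'n)) set" where
  "Sp_complex = {S. transpose S ** J_mat ** S = J_mat}"

definition Sp_real :: "(complex^('n + 'n)^('n::finite + 'n)) set" where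
  "Sp_real = {S \<in> Sp_complex. \<forall>i j. S $ i $ j \<in> \<real>}"

definition symp_form :: "complex^('n::finite + 'n) \<Rightarrow> complex^('n + 'n) \<Rightarrow> complex" where
  "symp_form z w = (\<Sum>i\<in>UNIV. (J_mat *v z) $ i * w $ i)"

definition cnj_vec :: "complex^'m::finite \<Rightarrow> complex^'m" where
  "cnj_vec z = (\<chi> i. cnj (z $ i))"

definition Sp_plus :: "(complex^('n + 'n)^('n::finite + 'n)) set" where
  "Sp_plus = {S \<in> Sp_complex. \<forall>z.
     inverse \<i> * (symp_form (S *v z) (cnj_vec (S *v z)) - symp_form z (cnj_vec z)) \<in> \<real>\<^sub>\<ge>\<^sub>0}"


section \<open>The metaplectic group\<close>

definition fourier_op :: "(real^'n::finite) L2 \<Rightarrow> (real^'n) L2" where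
  "fourier_op f = cscale_L2 (\<i> powr (- of_nat CARD('n) / 2)) (fourier_L2 f)"

definition chirp_op :: "real^'n^'n \<Rightarrow> (real^'n::finite) L2 \<Rightarrow> (real^'n) L2" where
  "chirp_op Q f = L2_of (\<lambda>x. exp (\<i> * pi * of_real ((Q *v x) \<bullet> x)) * rep_L2 f x)"

definition dilation_op :: "real^'n^'n \<Rightarrow> int \<Rightarrow> (real^'n::finite) L2 \<Rightarrow> (real^'n) L2" where
  "dilation_op E m f = L2_of (\<lambda>x. \<i> powi m * sqrt \<bar>det E\<bar> * rep_L2 f (E *v x))"

definition dilation_params :: "real^'n^'n \<Rightarrow> int \<Rightarrow> bool" where
  "dilation_params E m \<longleftrightarrow> invertible E \<and> is_Arg (of_real (det E)) (of_int m * pi)"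

inductive_set Mp :: "((real^'n::finite) L2 \<Rightarrow> (real^'n) L2) set" where
  fourier: "fourier_op \<in> Mp"
| chirp: "transpose Q = Q \<Longrightarrow> chirp_op Q \<in> Mp"
| dilation: "dilation_params E m \<Longrightarrow> dilation_op E m \<in> Mp"
| comp: "T \<in> Mp \<Longrightarrow> U \<in> Mp \<Longrightarrow> T \<circ> U \<in> Mp"
| inverse: "T \<in> Mp \<Longrightarrow> T \<circ> U = id \<Longrightarrow> U \<circ> T = id \<Longrightarrow> U \<in> Mp"

text \<open>\<open>is_proj_Mp \<pi>\<close>: the restriction of \<open>\<pi>\<close> to \<open>Mp\<close> is the projection onto the real symplectic group.\<close>

definition is_proj_Mp ::
  "(((real^'n::finite) L2 \<Rightarrow> (real^'n) L2) \<Rightarrow> complex^('n + 'n)^('n + 'n)) \<Rightarrow> bool" where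
  "is_proj_Mp \<pi> \<longleftrightarrow>
     \<pi> ` Mp = Sp_real \<and>
     (\<forall>T\<in>Mp. \<forall>U\<in>Mp. \<pi> (T \<circ> U) = \<pi> T ** \<pi> U) \<and>
     \<pi> fourier_op = J_mat \<and>
     (\<forall>Q. transpose Q = Q \<longrightarrow> \<pi> (chirp_op Q) = V_mat Q) \<and>
     (\<forall>E m. dilation_params E m \<longrightarrow> \<pi> (dilation_op E m) = D_mat E)"


section \<open>Metaplectic contractions\<close>

text \<open>The one-dimensional factors: \<open>Rot \<theta>\<close> stands for $\mathfrak{R}_\vartheta$, and \<open>Gauss \<alpha>\<close> for $\mathfrak{p}_{i\alpha}$.\<close>

datatype atom = Rot real | Gauss real

fun atom_params :: "atom \<Rightarrow> bool" where
  "atom_params (Rot \<theta>) \<longleftrightarrow> \<theta> \<ge> 0"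
| "atom_params (Gauss \<alpha>) \<longleftrightarrow> \<alpha> > 0"

fun atom_op :: "atom \<Rightarrow> real L2 \<Rightarrow> real L2" where
  "atom_op (Rot \<theta>) f = cscale_L2 (of_real (cosh \<theta> powr (- 1 / 2)))
     (integral_op
        (\<lambda>x \<eta>. exp (\<i> * pi * (2 * x * \<eta> + \<i> * (x\<^sup>2 + \<eta>\<^sup>2) * sinh \<theta>) / cosh \<theta>))
        (fourier_L2 f))"
| "atom_op (Gauss \<alpha>) f = L2_of (\<lambda>x. exp (- pi * \<alpha> * x\<^sup>2) * rep_L2 f x)"

fun atom_a :: "atom \<Rightarrow> complex" where
  "atom_a (Rot \<theta>) = cosh \<theta>"
| "atom_a (Gauss \<alpha>) = 1"

fun atom_b :: "atom \<Rightarrow> complex" where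
  "atom_b (Rot \<theta>) = - \<i> * sinh \<theta>"
| "atom_b (Gauss \<alpha>) = 0"

fun atom_c :: "atom \<Rightarrow> complex" where
  "atom_c (Rot \<theta>) = \<i> * sinh \<theta>"
| "atom_c (Gauss \<alpha>) = \<i> * \<alpha>"

fun atom_d :: "atom \<Rightarrow> complex" where
  "atom_d (Rot \<theta>) = cosh \<theta>"
| "atom_d (Gauss \<alpha>) = 1"

definition tensor_L2 :: "('n \<Rightarrow> real L2) \<Rightarrow> (real^'n::finite) L2" where
  "tensor_L2 f = L2_of (\<lambda>x. \<Prod>j\<in>UNIV. rep_L2 (f j) (x $ j))"

text \<open>
  The tensor product of the bounded operators \<open>X j\<close> is the bounded linear operator acting
  factorwise on elementary tensors; it is unique because these span a dense subspace.
\<close>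

definition is_tensor_op ::
  "((real^'n::finite) L2 \<Rightarrow> (real^'n) L2) \<Rightarrow> ('n \<Rightarrow> real L2 \<Rightarrow> real L2) \<Rightarrow> bool" where
  "is_tensor_op T X \<longleftrightarrow>
     bounded_linear T \<and> (\<forall>c f. T (cscale_L2 c f) = cscale_L2 c (T f)) \<and>
     (\<forall>f. T (tensor_L2 f) = tensor_L2 (\<lambda>j. X j (f j)))"

definition is_atomic_contraction ::
  "((real^'n::finite) L2 \<Rightarrow> (real^'n) L2) \<Rightarrow> ('n \<Rightarrow> atom) \<Rightarrow> bool" where
  "is_atomic_contraction T \<xi> \<longleftrightarrow>
     (\<forall>j. atom_params (\<xi> j)) \<and> is_tensor_op T (\<lambda>j. atom_op (\<xi> j))"

inductive_set Mp_plus :: "((real^'n::finite) L2 \<Rightarrow> (real^'n) L2) set" where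
  metaplectic: "T \<in> Mp \<Longrightarrow> T \<in> Mp_plus"
| atomic: "is_atomic_contraction T \<xi> \<Longrightarrow> T \<in> Mp_plus"
| comp: "T \<in> Mp_plus \<Longrightarrow> U \<in> Mp_plus \<Longrightarrow> T \<circ> U \<in> Mp_plus"

text \<open>
  \<open>is_proj_Mp_plus \<pi>\<close>: \<open>\<pi>\<close> is the projection of \<open>Mp_plus\<close>, i.e. the homomorphism into \<open>Sp_plus\<close>
  that extends the projection of \<open>Mp\<close> and has the prescribed values on atomic contractions. These
  conditions determine \<open>\<pi>\<close> on \<open>Mp_plus\<close>; its values elsewhere are irrelevant.
\<close>

definition is_proj_Mp_plus ::
  "(((real^'n::finite) L2 \<Rightarrow> (real^'n) L2) \<Rightarrow> complex^('n + 'n)^('n + 'n)) \<Rightarrow> bool" where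
  "is_proj_Mp_plus \<pi> \<longleftrightarrow>
     \<pi> ` Mp_plus \<subseteq> Sp_plus \<and>
     (\<forall>T\<in>Mp_plus. \<forall>U\<in>Mp_plus. \<pi> (T \<circ> U) = \<pi> T ** \<pi> U) \<and>
     is_proj_Mp \<pi> \<and>
     (\<forall>T \<xi>. is_atomic_contraction T \<xi> \<longrightarrow>
        \<pi> T = block_mat (diag_mat (\<lambda>j. atom_a (\<xi> j))) (diag_mat (\<lambda>j. atom_b (\<xi> j)))
                        (diag_mat (\<lambda>j. atom_c (\<xi> j))) (diag_mat (\<lambda>j. atom_d (\<xi> j))))"

end

theory Submission
  imports Defs
begin

text \<open>
  Let \<open>C\<close> be complex conjugation of functions. The map \<open>T \<mapsto> C T C\<close> is multiplicative, and so is
  the map \<open>conj_symp\<close> sending a matrix with blocks \<open>A, B, C, D\<close> to the one with blocks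
  \<open>cnj A, - cnj B, - cnj C, cnj D\<close>, since it is entrywise conjugation followed by conjugation with
  \<open>diag(I, -I)\<close>. Hence it suffices to compare the two maps on generators, by induction over the
  semigroup, with the following outcome.

  \<^item> For the Fourier transform, \<open>C F C\<close> has the conjugate kernel and the conjugate phase, so it equals
    \<open>F\<close> composed with the dilation by \<open>-I\<close> with \<open>m = d\<close>, whose phase \<open>i^d\<close> turns \<open>i^(-d/2)\<close>
    into \<open>i^(d/2)\<close>. The projection of this product is \<open>J (-I) = -J\<close>, which is \<open>conj_symp J\<close>
    (\<open>conj_op_fourier\<close>).

  \<^item> The chirp of \<open>Q\<close> becomes the chirp of \<open>-Q\<close>, and the dilation by \<open>E\<close> with phase \<open>m\<close> becomes
    the one with phase \<open>-m\<close> (\<open>conj_op_chirp\<close>, \<open>conj_op_dilation\<close>).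

  \<^item> Atomic contractions commute with \<open>C\<close>. The multiplication by a Gaussian is real. In
    $\mathfrak{R}_\vartheta$, conjugation reflects the variable \<open>\<eta>\<close> both in the Fourier transform
    and in the kernel, and the two reflections cancel (\<open>conj_op_atom\<close>). The matrices of these
    operators are fixed by \<open>conj_symp\<close>, as their diagonal blocks are real and their off-diagonal
    blocks purely imaginary.

  The analytic content is that conjugation and reflection commute with mean limits of truncated
  integrals (\<open>integral_op_intertwine\<close>), and that almost-everywhere identities between functions of
  one variable persist in elementary tensors (\<open>AE_lborel_nth\<close>).
\<close>

section \<open>Square-integrable functions modulo null sets\<close>

declare borel_measurable_cnj [measurable]

lemma square_integrable_rep_L2: "square_integrable (rep_L2 f)"
  using Quotient_rep_reflp[OF Quotient_L2, of f] by (simp add: L2_rel_def)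

lemma L2_of_rep_L2 [simp]: "L2_of (rep_L2 f) = f"
  using Quotient_abs_rep[OF Quotient_L2, of f] by (simp add: L2_of_def square_integrable_rep_L2)

lemma rep_L2_measurable [measurable]: "rep_L2 f \<in> borel_measurable borel"
  using square_integrable_rep_L2[of f] by (simp add: square_integrable_def)

text \<open>
  Square-integrability passes from one function to the other, and where it fails both classes are 0
  by convention. Operators defined through representatives are rewritten inside \<open>L2_of\<close> with this
  rule.
\<close>

lemma L2_of_cong:
  assumes "g \<in> borel_measurable borel" "h \<in> borel_measurable borel" "AE x in lborel. g x = h x"
  shows "L2_of g = L2_of h"
proof -
  have "integrable lborel (\<lambda>x. (cmod (g x))\<^sup>2) \<longleftrightarrow> integrable lborel (\<lambda>x. (cmod (h x))\<^sup>2)"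
    by (rule integrable_cong_AE) (use assms in auto)
  then have "square_integrable g \<longleftrightarrow> square_integrable h"
    using assms by (simp add: square_integrable_def)
  moreover have "abs_L2 g = abs_L2 h" if "square_integrable g" "square_integrable h"
    by (rule Quotient_rel_abs[OF Quotient_L2]) (use that assms in \<open>simp add: L2_rel_def\<close>)
  ultimately show ?thesis
    by (simp add: L2_of_def)
qed

lemma rep_L2_of:
  assumes "square_integrable g"
  shows "AE x in lborel. rep_L2 (L2_of g) x = g x"
proof -
  have "L2_rel (rep_L2 (abs_L2 g)) g"
    by (rule Quotient_rep_abs[OF Quotient_L2]) (use assms in \<open>simp add: L2_rel_def\<close>)
  then show ?thesis
    using assms by (simp add: L2_of_def L2_rel_def)
qed

lemma L2_eqI:
  assumes "AE x in lborel. rep_L2 f x = rep_L2 g x"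
  shows "f = g"
  using L2_of_cong[OF _ _ assms] by simp

lemma rep_L2_0: "AE x in lborel. rep_L2 0 x = 0"
  using rep_L2_of[OF square_integrable_zero]
  by (simp add: L2_of_def square_integrable_zero zero_L2.abs_eq)

lemma rep_L2_add: "AE x in lborel. rep_L2 (f + g) x = rep_L2 f x + rep_L2 g x"
proof -
  have "f + g = L2_of (\<lambda>x. rep_L2 f x + rep_L2 g x)"
    by (simp add: plus_L2_def L2_of_def square_integrable_add square_integrable_rep_L2)
  then show ?thesis
    using rep_L2_of[OF square_integrable_add[OF square_integrable_rep_L2[of f] square_integrable_rep_L2[of g]]]
    by metis
qed

lemma rep_L2_scaleR: "AE x in lborel. rep_L2 (r *\<^sub>R f) x = of_real r * rep_L2 f x"
proof -
  have "r *\<^sub>R f = L2_of (\<lambda>x. of_real r * rep_L2 f x)"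
    by (simp add: scaleR_L2_def L2_of_def square_integrable_cmult square_integrable_rep_L2)
  then show ?thesis
    using rep_L2_of[OF square_integrable_cmult[OF square_integrable_rep_L2[of f], of "of_real r"]]
    by metis
qed

lemma norm_L2_eq: "norm f = sqrt (LINT x|lborel. (cmod (rep_L2 f x))\<^sup>2)"
  by (simp only: norm_L2_def inner_L2.rep_eq complex_norm_square[symmetric]
        integral_complex_of_real Re_complex_of_real)

lemma square_integrable_cnj_iff [simp]: "square_integrable (\<lambda>x. cnj (g x)) \<longleftrightarrow> square_integrable g"
proof -
  have "square_integrable (\<lambda>x. cnj (h x))" if "square_integrable h" for h :: "'a \<Rightarrow> complex"
    using that by (auto simp: square_integrable_def intro: borel_measurable_cnj)
  from this[of g] this[of "\<lambda>x. cnj (g x)"] show ?thesis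
    by auto
qed

lemma rep_cnj_L2: "AE x in lborel. rep_L2 (cnj_L2 f) x = cnj (rep_L2 f x)"
  unfolding cnj_L2_def by (rule rep_L2_of) (simp add: square_integrable_rep_L2)

lemma cnj_L2_0 [simp]: "cnj_L2 0 = 0"
proof (rule L2_eqI)
  show "AE x in lborel. rep_L2 (cnj_L2 0) x = rep_L2 0 x"
    using rep_cnj_L2[of 0] rep_L2_0 by eventually_elim simp
qed

text \<open>
  A function and its conjugate are square-integrable together, and if they are not, both sides are 0.
  So the identity applies to truncated integrals whatever their kernel is. The same argument proves
  \<open>cscale_L2_of\<close> for a factor other than 0, and \<open>parity_L2_of\<close>.
\<close>

lemma cnj_L2_of: "cnj_L2 (L2_of g) = L2_of (\<lambda>x. cnj (g x))"
proof (cases "square_integrable g")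
  case True
  have g [measurable]: "g \<in> borel_measurable borel"
    using True by (simp add: square_integrable_def)
  show ?thesis
    unfolding cnj_L2_def
  proof (rule L2_of_cong)
    show "AE x in lborel. cnj (rep_L2 (L2_of g) x) = cnj (g x)"
      using rep_L2_of[OF True] by eventually_elim simp
  qed measurable
next
  case False
  then show ?thesis by (simp add: L2_of_def)
qed

lemma cnj_cnj_L2 [simp]: "cnj_L2 (cnj_L2 f) = f"
proof (rule L2_eqI)
  show "AE x in lborel. rep_L2 (cnj_L2 (cnj_L2 f)) x = rep_L2 f x"
    using rep_cnj_L2[of f] rep_cnj_L2[of "cnj_L2 f"] by eventually_elim simp
qed

lemma bounded_linear_cnj_L2: "bounded_linear (cnj_L2 :: 'a::euclidean_space L2 \<Rightarrow> 'a L2)"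
proof (rule bounded_linear_intro[where K = 1])
  fix f g :: "'a L2" and r :: real
  show "cnj_L2 (f + g) = cnj_L2 f + cnj_L2 g"
  proof (rule L2_eqI)
    show "AE x in lborel. rep_L2 (cnj_L2 (f + g)) x = rep_L2 (cnj_L2 f + cnj_L2 g) x"
      using rep_cnj_L2[of "f + g"] rep_L2_add[of f g] rep_cnj_L2[of f] rep_cnj_L2[of g]
        rep_L2_add[of "cnj_L2 f" "cnj_L2 g"]
      by eventually_elim simp
  qed
  show "cnj_L2 (r *\<^sub>R f) = r *\<^sub>R cnj_L2 f"
  proof (rule L2_eqI)
    show "AE x in lborel. rep_L2 (cnj_L2 (r *\<^sub>R f)) x = rep_L2 (r *\<^sub>R cnj_L2 f) x"
      using rep_cnj_L2[of "r *\<^sub>R f"] rep_L2_scaleR[of r f] rep_cnj_L2[of f]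
        rep_L2_scaleR[of r "cnj_L2 f"]
      by eventually_elim simp
  qed
  have "(LINT x|lborel. (cmod (rep_L2 (cnj_L2 f) x))\<^sup>2) = (LINT x|lborel. (cmod (rep_L2 f x))\<^sup>2)"
  proof (rule integral_cong_AE)
    show "AE x in lborel. (cmod (rep_L2 (cnj_L2 f) x))\<^sup>2 = (cmod (rep_L2 f x))\<^sup>2"
      using rep_cnj_L2[of f] by eventually_elim simp
  qed measurable
  then show "norm (cnj_L2 f) \<le> norm f * 1"
    by (simp add: norm_L2_eq)
qed

lemma rep_cscale_L2: "AE x in lborel. rep_L2 (cscale_L2 c f) x = c * rep_L2 f x"
  unfolding cscale_L2_def by (intro rep_L2_of square_integrable_cmult square_integrable_rep_L2)

lemma cscale_cscale_L2: "cscale_L2 a (cscale_L2 b f) = cscale_L2 (a * b) f"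
proof (rule L2_eqI)
  show "AE x in lborel. rep_L2 (cscale_L2 a (cscale_L2 b f)) x = rep_L2 (cscale_L2 (a * b) f) x"
    using rep_cscale_L2[of a "cscale_L2 b f"] rep_cscale_L2[of b f] rep_cscale_L2[of "a * b" f]
    by eventually_elim simp
qed

lemma cscale_L2_1 [simp]: "cscale_L2 1 f = f"
  by (simp add: cscale_L2_def)

lemma cnj_cscale_L2: "cnj_L2 (cscale_L2 c f) = cscale_L2 (cnj c) (cnj_L2 f)"
proof (rule L2_eqI)
  show "AE x in lborel. rep_L2 (cnj_L2 (cscale_L2 c f)) x = rep_L2 (cscale_L2 (cnj c) (cnj_L2 f)) x"
    using rep_cscale_L2[of c f] rep_cnj_L2[of "cscale_L2 c f"] rep_cnj_L2[of f]
      rep_cscale_L2[of "cnj c" "cnj_L2 f"]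
    by eventually_elim simp
qed

lemma cscale_L2_of:
  assumes "c \<noteq> 0"
  shows "cscale_L2 c (L2_of g) = L2_of (\<lambda>x. c * g x)"
proof (cases "square_integrable g")
  case True
  have g [measurable]: "g \<in> borel_measurable borel"
    using True by (simp add: square_integrable_def)
  show ?thesis
    unfolding cscale_L2_def
  proof (rule L2_of_cong)
    show "AE x in lborel. c * rep_L2 (L2_of g) x = c * g x"
      using rep_L2_of[OF True] by eventually_elim simp
  qed measurable
next
  case False
  then have "\<not> square_integrable (\<lambda>x. c * g x)"
    using square_integrable_cmult[of "\<lambda>x. c * g x" "inverse c"] assms
    by (auto simp: mult.assoc[symmetric])
  moreover have "cscale_L2 c 0 = 0"
  proof (rule L2_eqI)
    show "AE x in lborel. rep_L2 (cscale_L2 c 0) x = rep_L2 0 x"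
      using rep_L2_0 rep_cscale_L2[of c 0] by eventually_elim simp
  qed
  ultimately show ?thesis
    using False by (simp add: L2_of_def)
qed

lemma bounded_linear_cscale_L2: "bounded_linear (cscale_L2 c :: 'a::euclidean_space L2 \<Rightarrow> 'a L2)"
proof (rule bounded_linear_intro[where K = "cmod c"])
  fix f g :: "'a L2" and r :: real
  show "cscale_L2 c (f + g) = cscale_L2 c f + cscale_L2 c g"
  proof (rule L2_eqI)
    show "AE x in lborel. rep_L2 (cscale_L2 c (f + g)) x = rep_L2 (cscale_L2 c f + cscale_L2 c g) x"
      using rep_cscale_L2[of c "f + g"] rep_L2_add[of f g] rep_cscale_L2[of c f] rep_cscale_L2[of c g]
        rep_L2_add[of "cscale_L2 c f" "cscale_L2 c g"]
      by eventually_elim (simp add: distrib_left)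
  qed
  show "cscale_L2 c (r *\<^sub>R f) = r *\<^sub>R cscale_L2 c f"
  proof (rule L2_eqI)
    show "AE x in lborel. rep_L2 (cscale_L2 c (r *\<^sub>R f)) x = rep_L2 (r *\<^sub>R cscale_L2 c f) x"
      using rep_cscale_L2[of c "r *\<^sub>R f"] rep_L2_scaleR[of r f] rep_cscale_L2[of c f]
        rep_L2_scaleR[of r "cscale_L2 c f"]
      by eventually_elim simp
  qed
  have "(LINT x|lborel. (cmod (rep_L2 (cscale_L2 c f) x))\<^sup>2)
      = (LINT x|lborel. (cmod c)\<^sup>2 * (cmod (rep_L2 f x))\<^sup>2)"
  proof (rule integral_cong_AE)
    show "AE x in lborel. (cmod (rep_L2 (cscale_L2 c f) x))\<^sup>2 = (cmod c)\<^sup>2 * (cmod (rep_L2 f x))\<^sup>2"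
      using rep_cscale_L2[of c f] by eventually_elim (simp add: norm_mult power_mult_distrib)
  qed measurable
  then show "norm (cscale_L2 c f) \<le> norm f * cmod c"
    by (simp add: norm_L2_eq real_sqrt_mult)
qed

section \<open>Null sets under changes of variables\<close>

lemma AE_lborel_iff_negligible: "(AE x in lborel. P x) \<longleftrightarrow> negligible {x. \<not> P x}"
proof
  assume "AE x in lborel. P x"
  then show "negligible {x. \<not> P x}"
    by (metis AE_E3 DiffD2 UNIV_I DiffI mem_Collect_eq negligible_iff_null_sets negligible_subset
        null_sets_completionI space_lborel space_borel subsetI)
next
  assume "negligible {x. \<not> P x}"
  then have "AE x in lebesgue. P x"
    by (intro AE_I') (auto simp: negligible_iff_null_sets)
  then show "AE x in lborel. P x"
    by (simp add: AE_completion_iff)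
qed

text \<open>
  The exceptional set of the transformed property lies in the image of the original one under
  \<open>h'\<close>, and linear images of negligible sets are negligible.
\<close>

lemma AE_lborel_linear_left_inverse:
  fixes h h' :: "'a::euclidean_space \<Rightarrow> 'a"
  assumes "AE x in lborel. P x" "linear h'" "\<And>x. h' (h x) = x"
  shows "AE x in lborel. P (h x)"
proof -
  have "negligible (h' ` {x. \<not> P x})"
    by (rule negligible_differentiable_image_negligible)
       (use assms in \<open>auto simp: AE_lborel_iff_negligible linear_imp_differentiable_on\<close>)
  moreover have "{x. \<not> P (h x)} \<subseteq> h' ` {x. \<not> P x}"
    using assms(3) by (metis (mono_tags, lifting) image_eqI mem_Collect_eq subsetI)
  ultimately show ?thesis
    unfolding AE_lborel_iff_negligible by (rule negligible_subset)
qed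

lemma lborel_distr_uminus_euclidean:
  "distr lborel borel uminus = (lborel :: 'a::euclidean_space measure)"
  using lborel_affine[of "-1 :: real" "0 :: 'a"] by (simp add: density_1)

text \<open>
  A cylinder over a null set of the line is a null set of \<open>\<real>\<^sup>n\<close>: its measure is a product of
  one factor 0 and factors \<open>\<infinity>\<close>, and \<open>0 * \<infinity> = 0\<close> for \<open>ennreal\<close>.
\<close>

lemma AE_lborel_nth:
  fixes j :: "'n::finite"
  assumes "AE t in lborel. P t"
  shows "AE x in lborel. P ((x :: real^'n) $ j)"
proof -
  obtain N where N: "{t. \<not> P t} \<subseteq> N" "N \<in> sets borel" "emeasure lborel N = 0"
    using AE_E[OF assms] by auto
  define f where "f b = (if b = axis j 1 then indicator N else (\<lambda>_. 1 :: ennreal))" for b :: "real^'n"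
  have *: "indicator {x. x $ j \<in> N} x = (\<Prod>b\<in>Basis. f b (x \<bullet> b))" for x :: "real^'n"
  proof -
    have "(\<Prod>b\<in>Basis. f b (x \<bullet> b)) = (\<Prod>b\<in>{axis j 1}. f b (x \<bullet> b))"
      by (rule prod.mono_neutral_right) (auto simp: f_def)
    then show ?thesis
      by (simp add: f_def inner_axis indicator_def)
  qed
  have "emeasure lborel {x :: real^'n. x $ j \<in> N} = (\<integral>\<^sup>+x. (\<Prod>b\<in>Basis. f b (x \<bullet> b)) \<partial>lborel)"
    unfolding *[symmetric] using N by simp
  also have "\<dots> = (\<Prod>b\<in>Basis. (\<integral>\<^sup>+x. f b x \<partial>lborel))"
    by (rule nn_integral_lborel_prod) (use N in \<open>auto simp: f_def\<close>)
  also have "\<dots> = 0"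
    by (rule prod_zero) (use N in \<open>auto intro!: bexI[of _ "axis j 1"] simp: f_def\<close>)
  finally show ?thesis
    by (rule AE_I'[OF null_setsI]) (use N in auto)
qed

section \<open>The parity operator\<close>

definition parity_L2 :: "'a::euclidean_space L2 \<Rightarrow> 'a L2" where
  "parity_L2 f = L2_of (\<lambda>x. rep_L2 f (- x))"

lemma integrable_uminus_euclidean:
  fixes g :: "'a::euclidean_space \<Rightarrow> 'b::{banach, second_countable_topology}"
  assumes "integrable lborel g"
  shows "integrable lborel (\<lambda>x. g (- x))"
proof -
  have "integrable (distr lborel borel uminus) g"
    using assms by (simp add: lborel_distr_uminus_euclidean)
  then show ?thesis
    by (rule integrable_distr[rotated]) simp
qed

lemma integral_uminus_euclidean:
  fixes g :: "'a::euclidean_space \<Rightarrow> 'b::{banach, second_countable_topology}"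
  assumes "g \<in> borel_measurable borel"
  shows "(LINT x|lborel. g (- x)) = (LINT x|lborel. g x)"
  using integral_distr[of uminus lborel borel g] assms
  by (simp add: lborel_distr_uminus_euclidean)

lemma square_integrable_uminus_iff [simp]:
  "square_integrable (\<lambda>x. g (- x)) \<longleftrightarrow> square_integrable g"
proof -
  have "square_integrable (\<lambda>x. h (- x))" if "square_integrable h" for h :: "'a \<Rightarrow> complex"
    using that integrable_uminus_euclidean[of "\<lambda>x. (cmod (h x))\<^sup>2"]
    by (auto simp: square_integrable_def)
  from this[of g] this[of "\<lambda>x. g (- x)"] show ?thesis
    by auto
qed

lemma AE_lborel_uminus:
  fixes P :: "'a::euclidean_space \<Rightarrow> bool"
  shows "AE x in lborel. P x \<Longrightarrow> AE x in lborel. P (- x)"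
  by (rule AE_lborel_linear_left_inverse[where h' = uminus]) (auto intro: linear_uminus)

lemma rep_parity_L2: "AE x in lborel. rep_L2 (parity_L2 f) x = rep_L2 f (- x)"
  unfolding parity_L2_def by (rule rep_L2_of) (simp add: square_integrable_rep_L2)

lemma parity_L2_0 [simp]: "parity_L2 0 = 0"
proof (rule L2_eqI)
  show "AE x in lborel. rep_L2 (parity_L2 0) x = rep_L2 0 x"
    using rep_parity_L2[of 0] rep_L2_0 AE_lborel_uminus[OF rep_L2_0] by eventually_elim simp
qed

lemma parity_L2_of: "parity_L2 (L2_of g) = L2_of (\<lambda>x. g (- x))"
proof (cases "square_integrable g")
  case True
  have g [measurable]: "g \<in> borel_measurable borel"
    using True by (simp add: square_integrable_def)
  show ?thesis
    unfolding parity_L2_def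
  proof (rule L2_of_cong)
    show "AE x in lborel. rep_L2 (L2_of g) (- x) = g (- x)"
      using rep_L2_of[OF True] by (rule AE_lborel_uminus)
  qed measurable
next
  case False
  then show ?thesis by (simp add: L2_of_def)
qed

lemma parity_parity_L2 [simp]: "parity_L2 (parity_L2 f) = f"
  unfolding parity_L2_def[of f] by (simp add: parity_L2_of)

lemma bounded_linear_parity_L2:
  "bounded_linear (parity_L2 :: 'a::euclidean_space L2 \<Rightarrow> 'a L2)"
proof (rule bounded_linear_intro[where K = 1])
  fix f g :: "'a L2" and r :: real
  show "parity_L2 (f + g) = parity_L2 f + parity_L2 g"
  proof (rule L2_eqI)
    show "AE x in lborel. rep_L2 (parity_L2 (f + g)) x = rep_L2 (parity_L2 f + parity_L2 g) x"
      using rep_parity_L2[of "f + g"] AE_lborel_uminus[OF rep_L2_add[of f g]]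
        rep_parity_L2[of f] rep_parity_L2[of g] rep_L2_add[of "parity_L2 f" "parity_L2 g"]
      by eventually_elim simp
  qed
  show "parity_L2 (r *\<^sub>R f) = r *\<^sub>R parity_L2 f"
  proof (rule L2_eqI)
    show "AE x in lborel. rep_L2 (parity_L2 (r *\<^sub>R f)) x = rep_L2 (r *\<^sub>R parity_L2 f) x"
      using rep_parity_L2[of "r *\<^sub>R f"] AE_lborel_uminus[OF rep_L2_scaleR[of r f]]
        rep_parity_L2[of f] rep_L2_scaleR[of r "parity_L2 f"]
      by eventually_elim simp
  qed
  have "(LINT x|lborel. (cmod (rep_L2 (parity_L2 f) x))\<^sup>2) = (LINT x|lborel. (cmod (rep_L2 f (- x)))\<^sup>2)"
  proof (rule integral_cong_AE)
    show "AE x in lborel. (cmod (rep_L2 (parity_L2 f) x))\<^sup>2 = (cmod (rep_L2 f (- x)))\<^sup>2"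
      using rep_parity_L2[of f] by eventually_elim simp
  qed measurable
  also have "\<dots> = (LINT x|lborel. (cmod (rep_L2 f x))\<^sup>2)"
    by (rule integral_uminus_euclidean[of "\<lambda>x. (cmod (rep_L2 f x))\<^sup>2"]) measurable
  finally show "norm (parity_L2 f) \<le> norm f * 1"
    by (simp add: norm_L2_eq)
qed

section \<open>Integral operators\<close>

text \<open>
  Convergence of the truncated integrals passes through the continuous map \<open>\<Phi>\<close>. The continuous
  left inverse \<open>\<Psi>\<close> transfers divergence, in which case both integral operators have the default
  value 0, and \<open>\<Phi> 0 = 0\<close>.
\<close>

lemma integral_op_intertwine:
  assumes \<Phi>: "bounded_linear \<Phi>" and \<Psi>: "bounded_linear \<Psi>" and inv: "\<And>g. \<Psi> (\<Phi> g) = g"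
    and eq: "\<And>n. truncated_integral_op K' f' n = \<Phi> (truncated_integral_op K f n)"
  shows "integral_op K' f' = \<Phi> (integral_op K f)"
proof -
  let ?X = "truncated_integral_op K f"
  have K': "truncated_integral_op K' f' = (\<lambda>n. \<Phi> (?X n))"
    using eq by auto
  have lim: "(\<lambda>n. \<Phi> (?X n)) \<longlonglongrightarrow> \<Phi> l" if "?X \<longlonglongrightarrow> l" for l
    by (rule bounded_linear.tendsto[OF \<Phi> that])
  show ?thesis
  proof (cases "convergent ?X")
    case True
    then have "(\<lambda>n. \<Phi> (?X n)) \<longlonglongrightarrow> \<Phi> (lim ?X)"
      by (intro lim) (simp add: convergent_LIMSEQ_iff)
    then show ?thesis
      using True unfolding integral_op_def K' by (auto simp: limI convergent_def)
  next
    case False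
    have "\<not> convergent (\<lambda>n. \<Phi> (?X n))"
    proof
      assume "convergent (\<lambda>n. \<Phi> (?X n))"
      then obtain l where "(\<lambda>n. \<Phi> (?X n)) \<longlonglongrightarrow> l"
        by (auto simp: convergent_def)
      from bounded_linear.tendsto[OF \<Psi> this] show False
        using False by (auto simp: inv convergent_def)
    qed
    then show ?thesis
      using False unfolding integral_op_def K' by (simp add: bounded_linear.linear[OF \<Phi>] linear_0)
  qed
qed

lemma integral_op_cnj:
  fixes K :: "'a::euclidean_space \<Rightarrow> 'a \<Rightarrow> complex"
  assumes K: "\<And>y. K y \<in> borel_measurable borel"
  shows "integral_op (\<lambda>y x. cnj (K y x)) (cnj_L2 f) = cnj_L2 (integral_op K f)"
proof (rule integral_op_intertwine[OF bounded_linear_cnj_L2 bounded_linear_cnj_L2 cnj_cnj_L2])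
  fix n
  have "(LINT x:cball 0 (real n)|lborel. cnj (K y x) * rep_L2 (cnj_L2 f) x)
      = cnj (LINT x:cball 0 (real n)|lborel. K y x * rep_L2 f x)" for y
  proof -
    note K[of y, measurable]
    have [measurable]: "cball (0 :: 'a) (real n) \<in> sets borel"
      by simp
    have "(LINT x:cball 0 (real n)|lborel. cnj (K y x) * rep_L2 (cnj_L2 f) x)
        = (LINT x:cball 0 (real n)|lborel. cnj (K y x) * cnj (rep_L2 f x))"
      unfolding set_lebesgue_integral_def
    proof (rule integral_cong_AE)
      show "AE x in lborel. indicator (cball 0 (real n)) x *\<^sub>R (cnj (K y x) * rep_L2 (cnj_L2 f) x)
          = indicator (cball 0 (real n)) x *\<^sub>R (cnj (K y x) * cnj (rep_L2 f x))"
        using rep_cnj_L2[of f] by eventually_elim simp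
    qed measurable
    also have "\<dots> = (LINT x|lborel. cnj (indicator (cball 0 (real n)) x *\<^sub>R (K y x * rep_L2 f x)))"
      by (simp add: set_lebesgue_integral_def)
    finally show ?thesis
      by (simp add: set_lebesgue_integral_def del: complex_cnj_scaleR)
  qed
  then show "truncated_integral_op (\<lambda>y x. cnj (K y x)) (cnj_L2 f) n = cnj_L2 (truncated_integral_op K f n)"
    by (simp add: truncated_integral_op_def cnj_L2_of)
qed

lemma integral_op_parity_right:
  fixes K :: "'a::euclidean_space \<Rightarrow> 'a \<Rightarrow> complex"
  assumes K: "\<And>y. K y \<in> borel_measurable borel"
  shows "integral_op (\<lambda>y x. K y (- x)) (parity_L2 f) = integral_op K f"
proof (rule integral_op_intertwine[where \<Phi> = "\<lambda>f. f" and \<Psi> = "\<lambda>f. f"])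
  fix n
  have "(LINT x:cball 0 (real n)|lborel. K y (- x) * rep_L2 (parity_L2 f) x)
      = (LINT x:cball 0 (real n)|lborel. K y x * rep_L2 f x)" for y
  proof -
    note K[of y, measurable]
    have [measurable]: "cball (0 :: 'a) (real n) \<in> sets borel"
      by simp
    let ?g = "\<lambda>x. indicator (cball 0 (real n)) x *\<^sub>R (K y x * rep_L2 f x)"
    have "(LINT x:cball 0 (real n)|lborel. K y (- x) * rep_L2 (parity_L2 f) x)
        = (LINT x|lborel. ?g (- x))"
      unfolding set_lebesgue_integral_def
    proof (rule integral_cong_AE)
      show "AE x in lborel. indicator (cball 0 (real n)) x *\<^sub>R (K y (- x) * rep_L2 (parity_L2 f) x)
          = ?g (- x)"
        using rep_parity_L2[of f] by eventually_elim (simp add: indicator_def)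
    qed measurable
    also have "\<dots> = (LINT x|lborel. ?g x)"
      by (rule integral_uminus_euclidean) measurable
    finally show ?thesis
      by (simp add: set_lebesgue_integral_def)
  qed
  then show "truncated_integral_op (\<lambda>y x. K y (- x)) (parity_L2 f) n = truncated_integral_op K f n"
    by (simp add: truncated_integral_op_def)
qed auto

lemma integral_op_parity_left:
  "integral_op (\<lambda>y x. K (- y) x) f = parity_L2 (integral_op K f)"
  by (rule integral_op_intertwine[OF bounded_linear_parity_L2 bounded_linear_parity_L2 parity_parity_L2])
     (simp add: truncated_integral_op_def parity_L2_of)

lemma integral_op_cscale:
  fixes K :: "'a::euclidean_space \<Rightarrow> 'a \<Rightarrow> complex"
  assumes K: "\<And>y. K y \<in> borel_measurable borel" and c: "c \<noteq> 0"
  shows "integral_op K (cscale_L2 c f) = cscale_L2 c (integral_op K f)"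
proof (rule integral_op_intertwine[OF bounded_linear_cscale_L2 bounded_linear_cscale_L2])
  show "cscale_L2 (inverse c) (cscale_L2 c g) = g" for g :: "'a L2"
    using c by (simp add: cscale_cscale_L2)
  fix n
  have "(LINT x:cball 0 (real n)|lborel. K y x * rep_L2 (cscale_L2 c f) x)
      = c * (LINT x:cball 0 (real n)|lborel. K y x * rep_L2 f x)" for y
  proof -
    note K[of y, measurable]
    have [measurable]: "cball (0 :: 'a) (real n) \<in> sets borel"
      by simp
    have "(LINT x:cball 0 (real n)|lborel. K y x * rep_L2 (cscale_L2 c f) x)
        = (LINT x:cball 0 (real n)|lborel. c * (K y x * rep_L2 f x))"
      unfolding set_lebesgue_integral_def
    proof (rule integral_cong_AE)
      show "AE x in lborel. indicator (cball 0 (real n)) x *\<^sub>R (K y x * rep_L2 (cscale_L2 c f) x)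
          = indicator (cball 0 (real n)) x *\<^sub>R (c * (K y x * rep_L2 f x))"
        using rep_cscale_L2[of c f] by eventually_elim simp
    qed measurable
    then show ?thesis
      by simp
  qed
  then show "truncated_integral_op K (cscale_L2 c f) n = cscale_L2 c (truncated_integral_op K f n)"
    using c by (simp add: truncated_integral_op_def cscale_L2_of)
qed

lemma fourier_kernel_measurable [measurable]:
  "(\<lambda>x. exp (- 2 * pi * \<i> * of_real (\<eta> \<bullet> x))) \<in> borel_measurable borel"
  by (intro borel_measurable_continuous_onI continuous_intros)

lemma fourier_L2_cscale: "c \<noteq> 0 \<Longrightarrow> fourier_L2 (cscale_L2 c f) = cscale_L2 c (fourier_L2 f)"
  unfolding fourier_L2_def by (rule integral_op_cscale) measurable

text \<open>
  Conjugating the kernel of the Fourier transform amounts to reflecting either of its two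
  variables. Reflecting \<open>x\<close> yields the transform of the reflected function, and reflecting \<open>\<eta>\<close>
  the reflected transform.
\<close>

lemma cnj_fourier_L2_cnj: "cnj_L2 (fourier_L2 (cnj_L2 f)) = fourier_L2 (parity_L2 f)"
  and fourier_L2_parity: "fourier_L2 (parity_L2 f) = parity_L2 (fourier_L2 f)"
proof -
  let ?K = "\<lambda>\<eta> x :: 'a. exp (- 2 * pi * \<i> * of_real (\<eta> \<bullet> x))"
  have "cnj_L2 (fourier_L2 (cnj_L2 f)) = integral_op (\<lambda>\<eta> x. cnj (?K \<eta> x)) (cnj_L2 (cnj_L2 f))"
    unfolding fourier_L2_def by (rule integral_op_cnj[symmetric]) measurable
  also have "(\<lambda>\<eta> x. cnj (?K \<eta> x)) = (\<lambda>\<eta> x. ?K (- \<eta>) x)"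
    by (simp add: exp_cnj)
  finally have 1: "cnj_L2 (fourier_L2 (cnj_L2 f)) = integral_op (\<lambda>\<eta> x. ?K (- \<eta>) x) f"
    by simp
  also have "\<dots> = integral_op (\<lambda>\<eta> x. ?K \<eta> (- x)) (parity_L2 (parity_L2 f))"
    by simp
  also have "\<dots> = fourier_L2 (parity_L2 f)"
    unfolding fourier_L2_def by (rule integral_op_parity_right) measurable
  finally show 2: "cnj_L2 (fourier_L2 (cnj_L2 f)) = fourier_L2 (parity_L2 f)" .
  have "integral_op (\<lambda>\<eta> x. ?K (- \<eta>) x) f = parity_L2 (fourier_L2 f)"
    unfolding fourier_L2_def by (rule integral_op_parity_left)
  then show "fourier_L2 (parity_L2 f) = parity_L2 (fourier_L2 f)"
    using 1 2 by simp
qed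

section \<open>Operators conjugated by complex conjugation\<close>

definition conj_op :: "('a::euclidean_space L2 \<Rightarrow> 'a L2) \<Rightarrow> 'a L2 \<Rightarrow> 'a L2" where
  "conj_op T = (\<lambda>f. cnj_L2 (T (cnj_L2 f)))"

lemma conj_op_comp: "conj_op (T \<circ> U) = conj_op T \<circ> conj_op U"
  by (simp add: conj_op_def fun_eq_iff)

lemma conj_op_id: "conj_op id = id"
  by (simp add: conj_op_def fun_eq_iff)

lemma continuous_on_matrix_vector_mult [continuous_intros]:
  fixes E :: "real^'n^'m"
  shows "continuous_on A (\<lambda>x. E *v x)"
  by (intro linear_continuous_on matrix_vector_mul_bounded_linear)

lemma matrix_inv_left:
  assumes "invertible A"
  shows "matrix_inv A ** A = mat 1"
  using someI_ex[of "\<lambda>A'. A ** A' = mat 1 \<and> A' ** A = mat 1"] assms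
  unfolding invertible_def matrix_inv_def by blast

lemma conj_op_chirp:
  fixes Q :: "real^'n::finite^'n"
  shows "conj_op (chirp_op Q) = chirp_op (- Q)"
proof
  fix f :: "(real^'n) L2"
  let ?e = "\<lambda>x. exp (\<i> * pi * of_real ((Q *v x) \<bullet> x))"
  have [measurable]: "?e \<in> borel_measurable borel"
    by (intro borel_measurable_continuous_onI continuous_intros)
  have eq: "chirp_op Q (cnj_L2 f) = L2_of (\<lambda>x. ?e x * cnj (rep_L2 f x))"
    unfolding chirp_op_def
  proof (rule L2_of_cong)
    show "AE x in lborel. ?e x * rep_L2 (cnj_L2 f) x = ?e x * cnj (rep_L2 f x)"
      using rep_cnj_L2[of f] by eventually_elim simp
  qed measurable
  have "- Q *v x = - (Q *v x)" for x
    using matrix_vector_mult_diff_rdistrib[of 0 Q x] by simp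
  then show "conj_op (chirp_op Q) f = chirp_op (- Q) f"
    unfolding conj_op_def eq by (simp add: cnj_L2_of chirp_op_def exp_cnj)
qed

lemma conj_op_dilation:
  fixes E :: "real^'n::finite^'n"
  assumes "invertible E"
  shows "conj_op (dilation_op E m) = dilation_op E (- m)"
proof
  fix f :: "(real^'n) L2"
  have [measurable]: "(\<lambda>x. E *v x) \<in> borel_measurable borel"
    by (intro borel_measurable_continuous_onI continuous_intros)
  have "AE x in lborel. rep_L2 (cnj_L2 f) (E *v x) = cnj (rep_L2 f (E *v x))"
    by (rule AE_lborel_linear_left_inverse[where h' = "(*v) (matrix_inv E)", OF rep_cnj_L2])
       (use assms in \<open>simp_all add: matrix_vector_mul_assoc matrix_inv_left\<close>)
  then have AE: "AE x in lborel. \<i> powi m * sqrt \<bar>det E\<bar> * rep_L2 (cnj_L2 f) (E *v x)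
      = \<i> powi m * sqrt \<bar>det E\<bar> * cnj (rep_L2 f (E *v x))"
    by eventually_elim simp
  have eq: "dilation_op E m (cnj_L2 f) = L2_of (\<lambda>x. \<i> powi m * sqrt \<bar>det E\<bar> * cnj (rep_L2 f (E *v x)))"
    unfolding dilation_op_def by (rule L2_of_cong[OF _ _ AE]) measurable
  have "cnj (\<i> powi m) = \<i> powi (- m)"
    by (simp add: power_int_def)
  then show "conj_op (dilation_op E m) f = dilation_op E (- m) f"
    unfolding conj_op_def eq by (simp add: cnj_L2_of dilation_op_def)
qed

lemma is_Arg_cnj:
  assumes "is_Arg z r"
  shows "is_Arg (cnj z) (- r)"
  using arg_cong[OF assms[unfolded is_Arg_def], of cnj] unfolding is_Arg_def complex_mod_cnj
  by (simp only: complex_cnj_mult complex_cnj_complex_of_real exp_cnj complex_cnj_i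
      mult_minus_left mult_minus_right of_real_minus)

lemma dilation_params_uminus: "dilation_params E m \<Longrightarrow> dilation_params E (- m)"
  using is_Arg_cnj[of "of_real (det E)" "of_int m * pi"] by (simp add: dilation_params_def)

lemma det_uminus_mat_1: "det (- mat 1 :: real^'n^'n) = (- 1) ^ CARD('n)"
proof -
  have "- mat 1 = (matrix ((*\<^sub>R) (- 1)) :: real^'n^'n)"
    by (simp add: matrix_def mat_def vec_eq_iff axis_def)
  then show ?thesis
    by (simp only: det_matrix_scaleR)
qed

lemma uminus_mat_1_mult: "(- mat 1 :: 'a::comm_ring_1^'n^'n) ** A = - A"
  and mult_uminus_mat_1: "A ** (- mat 1 :: 'a::comm_ring_1^'n^'n) = - A"
  by (simp_all add: matrix_matrix_mult_def mat_def vec_eq_iff sum_negf mult_delta_left mult_delta_right)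

lemma invertible_uminus_mat_1: "invertible (- mat 1 :: real^'n^'n)"
  unfolding invertible_def by (rule exI[of _ "- mat 1"]) (simp add: uminus_mat_1_mult)

lemma dilation_params_uminus_mat_1:
  "dilation_params (- mat 1 :: real^'n^'n) (int CARD('n))"
proof -
  have "exp (\<i> * (of_nat CARD('n) * of_real pi)) = (- 1 :: complex) ^ CARD('n)"
    using exp_of_nat_mult[of "CARD('n)" "\<i> * pi"] by (simp add: mult_ac)
  then show ?thesis
    by (simp add: dilation_params_def invertible_uminus_mat_1 is_Arg_def det_uminus_mat_1
        norm_power)
qed

text \<open>
  The exponent \<open>m = d\<close> of the dilation by \<open>-I\<close> is chosen so that its phase corrects the phase of
  the Fourier transform: \<open>i^(-d/2) * i^d\<close> is the conjugate of \<open>i^(-d/2)\<close>.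
\<close>

lemma conj_op_fourier:
  "conj_op (fourier_op :: (real^'n::finite) L2 \<Rightarrow> _)
    = fourier_op \<circ> dilation_op (- mat 1) (int CARD('n))"
proof
  fix f :: "(real^'n) L2"
  let ?c = "\<i> powr (- of_nat CARD('n) / 2)" and ?d = "\<i> ^ CARD('n)"
  have neg: "- mat 1 *v x = - x" for x :: "real^'n"
    using matrix_vector_mult_diff_rdistrib[of 0 "mat 1" x] by simp
  have AE: "AE x in lborel. ?d * rep_L2 f (- x) = ?d * rep_L2 (parity_L2 f) x"
    using rep_parity_L2[of f] by eventually_elim simp
  have "dilation_op (- mat 1) (int CARD('n)) f = L2_of (\<lambda>x. ?d * rep_L2 f (- x))"
    by (simp add: dilation_op_def det_uminus_mat_1 neg power_int_def)
  also have "\<dots> = cscale_L2 ?d (parity_L2 f)"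
    unfolding cscale_L2_def by (rule L2_of_cong[OF _ _ AE]) measurable
  finally have "(fourier_op \<circ> dilation_op (- mat 1) (int CARD('n))) f
      = cscale_L2 (?c * ?d) (fourier_L2 (parity_L2 f))"
    by (simp add: fourier_op_def fourier_L2_cscale cscale_cscale_L2)
  moreover have "?c * ?d = cnj ?c"
  proof -
    have "?d = \<i> powr of_nat CARD('n)"
      by (simp add: powr_nat')
    then have "?c * ?d = \<i> powr (- of_nat CARD('n) / 2 + of_nat CARD('n))"
      by (simp only: powr_add)
    also have "\<dots> = \<i> powr (of_nat CARD('n) / 2)"
      by (simp add: field_simps)
    also have "\<dots> = cnj ?c"
      by (simp add: powr_def exp_cnj)
    finally show ?thesis .
  qed
  ultimately show "conj_op fourier_op f = (fourier_op \<circ> dilation_op (- mat 1) (int CARD('n))) f"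
    by (simp add: conj_op_def fourier_op_def cnj_cscale_L2 cnj_fourier_L2_cnj)
qed

lemma cosh_sinh_of_real:
  "cosh (complex_of_real t) = of_real (cosh t)" "sinh (complex_of_real t) = of_real (sinh t)"
  by (simp_all add: cosh_def sinh_def exp_of_real[symmetric] scaleR_conv_of_real)

lemma conj_op_atom: "conj_op (atom_op a) = atom_op a"
proof
  fix f :: "real L2"
  show "conj_op (atom_op a) f = atom_op a f"
  proof (cases a)
    case (Gauss \<alpha>)
    have eq: "atom_op (Gauss \<alpha>) (cnj_L2 f) = L2_of (\<lambda>x. exp (- pi * \<alpha> * x\<^sup>2) * cnj (rep_L2 f x))"
      unfolding atom_op.simps
    proof (rule L2_of_cong)
      show "AE x in lborel. exp (- pi * \<alpha> * x\<^sup>2) * rep_L2 (cnj_L2 f) x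
          = exp (- pi * \<alpha> * x\<^sup>2) * cnj (rep_L2 f x)"
        using rep_cnj_L2[of f] by eventually_elim simp
    qed measurable
    show ?thesis
      unfolding Gauss conj_op_def eq by (simp add: cnj_L2_of)
  next
    case (Rot \<theta>)
    let ?K = "\<lambda>(x::real) (\<eta>::real). exp (\<i> * pi *
      (2 * x * \<eta> + \<i> * (x\<^sup>2 + \<eta>\<^sup>2) * sinh (complex_of_real \<theta>)) / cosh (complex_of_real \<theta>))"
    have meas: "?K x \<in> borel_measurable borel" for x :: real
      by (intro borel_measurable_continuous_onI continuous_intros) (simp add: cosh_sinh_of_real)
    have K: "(\<lambda>x \<eta>. cnj (?K x \<eta>)) = (\<lambda>x \<eta>. ?K x (- \<eta>))"
      unfolding exp_cnj by (intro ext arg_cong[where f = exp])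
        (simp add: cosh_sinh_of_real field_simps)
    \<comment> \<open>conjugation reflects the Fourier transform, and conjugating the kernel reflects it back\<close>
    define g where "g = parity_L2 (fourier_L2 f)"
    have "fourier_L2 (cnj_L2 f) = cnj_L2 g"
      unfolding g_def using cnj_fourier_L2_cnj[of f] by (metis cnj_cnj_L2 fourier_L2_parity)
    then have "conj_op (atom_op a) f
        = cscale_L2 (of_real (cosh \<theta> powr (- 1 / 2))) (cnj_L2 (integral_op ?K (cnj_L2 g)))"
      by (simp add: conj_op_def Rot cnj_cscale_L2)
    also have "cnj_L2 (integral_op ?K (cnj_L2 g)) = integral_op (\<lambda>x \<eta>. cnj (?K x \<eta>)) g"
      using integral_op_cnj[of ?K "cnj_L2 g", OF meas] by simp
    also have "\<dots> = integral_op ?K (fourier_L2 f)"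
      unfolding K g_def by (rule integral_op_parity_right[OF meas])
    also have "cscale_L2 (of_real (cosh \<theta> powr (- 1 / 2))) (integral_op ?K (fourier_L2 f)) = atom_op a f"
      by (simp add: Rot)
    finally show ?thesis .
  qed
qed

text \<open>
  The representative of a conjugated factor is only almost everywhere the conjugate of the
  representative of that factor, so the exceptional null set of each coordinate has to be lifted to
  \<open>\<real>\<^sup>n\<close>.
\<close>

lemma cnj_tensor_L2:
  fixes f :: "'n::finite \<Rightarrow> real L2"
  shows "cnj_L2 (tensor_L2 f) = tensor_L2 (\<lambda>j. cnj_L2 (f j))"
proof -
  have "AE x in lborel. \<forall>j\<in>UNIV. rep_L2 (cnj_L2 (f j)) ((x :: real^'n) $ j) = cnj (rep_L2 (f j) (x $ j))"
    by (intro AE_finite_allI finite AE_lborel_nth rep_cnj_L2)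
  then have AE: "AE x in lborel. cnj (\<Prod>j\<in>UNIV. rep_L2 (f j) ((x :: real^'n) $ j))
      = (\<Prod>j\<in>UNIV. rep_L2 (cnj_L2 (f j)) (x $ j))"
    by eventually_elim simp
  have [measurable]: "(\<lambda>x. rep_L2 (g j) ((x :: real^'n) $ j)) \<in> borel_measurable borel"
    for g :: "'n \<Rightarrow> real L2" and j
    by (rule measurable_compose[OF _ rep_L2_measurable])
       (intro borel_measurable_continuous_onI continuous_intros)
  have meas: "(\<lambda>x. \<Prod>j\<in>UNIV. rep_L2 (g j) ((x :: real^'n) $ j)) \<in> borel_measurable borel"
    for g :: "'n \<Rightarrow> real L2"
    by measurable
  show ?thesis
    unfolding tensor_L2_def cnj_L2_of
    by (rule L2_of_cong[OF borel_measurable_cnj[OF meas] meas AE])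
qed

lemma conj_op_tensor:
  assumes "is_tensor_op T X"
  shows "is_tensor_op (conj_op T) (\<lambda>j. conj_op (X j))"
proof -
  have "bounded_linear (conj_op T)"
    using assms bounded_linear_compose[OF bounded_linear_cnj_L2
        bounded_linear_compose[OF _ bounded_linear_cnj_L2], of T]
    by (simp add: is_tensor_op_def conj_op_def)
  then show ?thesis
    using assms by (simp add: is_tensor_op_def conj_op_def cnj_cscale_L2 cnj_tensor_L2)
qed

lemma conj_op_atomic_contraction:
  "is_atomic_contraction T \<xi> \<Longrightarrow> is_atomic_contraction (conj_op T) \<xi>"
  using conj_op_tensor[of T "\<lambda>j. atom_op (\<xi> j)"]
  by (simp add: is_atomic_contraction_def conj_op_atom)

section \<open>The conjugation of block matrices\<close>

definition sum_sign :: "'a + 'b \<Rightarrow> complex" where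
  "sum_sign i = (case i of Inl _ \<Rightarrow> 1 | Inr _ \<Rightarrow> - 1)"

text \<open>
  This is \<open>K ** map_matrix cnj S ** K\<close> with \<open>K = diag(I, -I)\<close>, written in entries.
\<close>

definition conj_symp :: "complex^('n + 'n)^('n::finite + 'n) \<Rightarrow> complex^('n + 'n)^('n + 'n)" where
  "conj_symp S = (\<chi> i j. sum_sign i * sum_sign j * cnj (S $ i $ j))"

lemma conj_symp_block_mat:
  "conj_symp (block_mat A B C D)
    = block_mat (map_matrix cnj A) (- map_matrix cnj B) (- map_matrix cnj C) (map_matrix cnj D)"
  by (auto simp: conj_symp_def block_mat_def sum_sign_def map_matrix_def vec_eq_iff split: sum.split)

text \<open>The two signs belonging to the summation index cancel, which is \<open>K ** K = I\<close>.\<close>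

lemma conj_symp_mult: "conj_symp (A ** B) = conj_symp A ** conj_symp B"
proof -
  have "sum_sign k = 1 \<or> sum_sign k = - 1" for k :: "'a + 'a"
    by (simp add: sum_sign_def split: sum.split)
  then have *: "sum_sign i * sum_sign j * cnj (A $ i $ k * B $ k $ j)
      = (sum_sign i * sum_sign k * cnj (A $ i $ k)) * (sum_sign k * sum_sign j * cnj (B $ k $ j))"
    (is "?l i j k = ?r i j k") for i j k
    by (rule disjE[of "sum_sign k = 1" "sum_sign k = - 1"]) (auto simp: mult_ac)
  have "conj_symp (A ** B) $ i $ j = (\<Sum>k\<in>UNIV. ?l i j k)" for i j
    by (simp add: conj_symp_def matrix_matrix_mult_def sum_distrib_left)
  then show ?thesis
    unfolding * by (simp add: conj_symp_def matrix_matrix_mult_def vec_eq_iff)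
qed

lemma conj_symp_diag_block_mat:
  "conj_symp (block_mat (diag_mat a) (diag_mat b) (diag_mat c) (diag_mat d))
    = block_mat (diag_mat (\<lambda>j. cnj (a j))) (diag_mat (\<lambda>j. - cnj (b j)))
                (diag_mat (\<lambda>j. - cnj (c j))) (diag_mat (\<lambda>j. cnj (d j)))"
proof -
  have "map_matrix cnj (diag_mat h) = diag_mat (\<lambda>j. cnj (h j))"
    "- diag_mat h = diag_mat (\<lambda>j. - h j)" for h :: "'a \<Rightarrow> complex"
    by (simp_all add: map_matrix_def diag_mat_def vec_eq_iff)
  then show ?thesis
    by (simp add: conj_symp_block_mat)
qed

lemma block_mat_1: "block_mat (mat 1) 0 0 (mat 1) = mat 1"
  by (auto simp: block_mat_def mat_def vec_eq_iff split: sum.split)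

lemma conj_symp_1: "conj_symp (mat 1) = mat 1"
  by (simp add: block_mat_1[symmetric] conj_symp_block_mat)
     (auto simp: map_matrix_def mat_def vec_eq_iff block_mat_def split: sum.split)

lemma matrix_inv_involution:
  assumes "A ** A = mat 1"
  shows "matrix_inv A = A"
proof -
  have "invertible A"
    using assms by (auto simp: invertible_def)
  then have "matrix_inv A ** (A ** A) = A"
    by (simp add: matrix_mul_assoc matrix_inv_left)
  then show ?thesis
    by (simp add: assms)
qed

lemma D_mat_1: "D_mat (mat 1) = mat 1"
  unfolding D_mat_def matrix_inv_involution[OF matrix_mul_lid]
  by (auto simp: block_mat_def mat_def map_matrix_def transpose_def vec_eq_iff split: sum.split)

lemma D_mat_uminus_1: "D_mat (- mat 1) = - mat 1"
proof -
  have inv: "matrix_inv (- mat 1 :: real^'a^'a) = - mat 1"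
    by (rule matrix_inv_involution) (simp add: uminus_mat_1_mult)
  show ?thesis
    unfolding D_mat_def inv
    by (auto simp: block_mat_def mat_def map_matrix_def transpose_def vec_eq_iff split: sum.split)
qed

lemma conj_symp_J: "conj_symp J_mat = - J_mat"
  by (auto simp: conj_symp_def J_mat_def sum_sign_def block_mat_def mat_def vec_eq_iff split: sum.split)

lemma conj_symp_V: "conj_symp (V_mat Q) = V_mat (- Q)"
  by (auto simp: conj_symp_def V_mat_def sum_sign_def map_matrix_def block_mat_def mat_def vec_eq_iff split: sum.split)

lemma conj_symp_D: "conj_symp (D_mat E) = D_mat E"
  by (auto simp: conj_symp_def D_mat_def sum_sign_def map_matrix_def block_mat_def mat_def vec_eq_iff split: sum.split)

section \<open>Projections of conjugated operators\<close>

text \<open>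
  The unit of the metaplectic group arises as a dilation, which shows that a projection sends it to
  the unit matrix.
\<close>

lemma dilation_op_id: "dilation_op (mat 1) 0 = id"
  by (simp add: dilation_op_def fun_eq_iff)

lemma dilation_params_id: "dilation_params (mat 1) 0"
  by (auto simp: dilation_params_def invertible_def is_Arg_def intro!: exI[of _ "mat 1"])

text \<open>
  Inverses form a separate step of the induction: the projection of \<open>conj_op U\<close> is a left inverse of
  \<open>conj_symp (\<pi> T)\<close>, while \<open>conj_symp (\<pi> U)\<close> is a right inverse, and so they agree.
\<close>

lemma conj_op_Mp:
  fixes \<pi> :: "((real^'n::finite) L2 \<Rightarrow> (real^'n) L2) \<Rightarrow> complex^('n + 'n)^('n + 'n)"
  assumes \<pi>: "is_proj_Mp \<pi>" and "T \<in> Mp"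
  shows "conj_op T \<in> Mp \<and> \<pi> (conj_op T) = conj_symp (\<pi> T)"
  using \<open>T \<in> Mp\<close>
proof induction
  case fourier
  have D: "dilation_op (- mat 1) (int CARD('n)) \<in> (Mp :: ((real^'n) L2 \<Rightarrow> _) set)"
    by (intro Mp.dilation dilation_params_uminus_mat_1)
  have "\<pi> (conj_op fourier_op) = \<pi> fourier_op ** \<pi> (dilation_op (- mat 1) (int CARD('n)))"
    unfolding conj_op_fourier using \<pi> D Mp.fourier unfolding is_proj_Mp_def by blast
  also have "\<dots> = J_mat ** D_mat (- mat 1)"
    using \<pi> dilation_params_uminus_mat_1[where 'n = 'n] by (simp add: is_proj_Mp_def)
  also have "\<dots> = conj_symp (\<pi> fourier_op)"
    using \<pi> by (simp add: D_mat_uminus_1 mult_uminus_mat_1 conj_symp_J is_proj_Mp_def)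
  finally have "\<pi> (conj_op fourier_op) = conj_symp (\<pi> fourier_op)" .
  moreover have "conj_op fourier_op \<in> (Mp :: ((real^'n) L2 \<Rightarrow> _) set)"
    unfolding conj_op_fourier by (rule Mp.comp[OF Mp.fourier D])
  ultimately show ?case
    by blast
next
  case (chirp Q)
  then have "transpose (- Q) = - Q"
    by (simp add: transpose_def vec_eq_iff)
  then show ?case
    using \<pi> chirp by (simp add: conj_op_chirp Mp.chirp is_proj_Mp_def conj_symp_V)
next
  case (dilation E m)
  then have "invertible E" "dilation_params E (- m)"
    by (simp add: dilation_params_def, simp add: dilation_params_uminus)
  then show ?case
    using \<pi> dilation by (simp add: conj_op_dilation Mp.dilation is_proj_Mp_def conj_symp_D)
next
  case (comp T U)
  then show ?case
    unfolding conj_op_comp using \<pi> Mp.comp[of "conj_op T" "conj_op U"]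
    by (simp add: is_proj_Mp_def conj_symp_mult del: comp_apply)
next
  case (inverse T U)
  have 1: "conj_op T \<circ> conj_op U = id" "conj_op U \<circ> conj_op T = id"
    using inverse.hyps by (simp_all add: conj_op_comp[symmetric] conj_op_id)
  then have U: "U \<in> Mp" "conj_op U \<in> Mp"
    using inverse by (auto intro: Mp.inverse)
  have "\<pi> (dilation_op (mat 1) 0) = D_mat (mat 1)"
    using \<pi> dilation_params_id unfolding is_proj_Mp_def by blast
  then have id: "\<pi> id = mat 1"
    by (simp add: dilation_op_id D_mat_1)
  have mult: "\<pi> (V \<circ> W) = \<pi> V ** \<pi> W" if "V \<in> Mp" "W \<in> Mp" for V W
    using \<pi> that by (simp add: is_proj_Mp_def)
  have left: "\<pi> (conj_op U) ** conj_symp (\<pi> T) = mat 1"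
    using mult[of "conj_op U" "conj_op T"] U inverse 1 id by simp
  have "\<pi> T ** \<pi> U = mat 1"
    using mult[OF \<open>T \<in> Mp\<close> U(1)] \<open>T \<circ> U = id\<close> id by simp
  then have right: "conj_symp (\<pi> T) ** conj_symp (\<pi> U) = mat 1"
    by (simp add: conj_symp_mult[symmetric] conj_symp_1)
  have "\<pi> (conj_op U) = \<pi> (conj_op U) ** (conj_symp (\<pi> T) ** conj_symp (\<pi> U))"
    by (simp add: right)
  also have "\<dots> = conj_symp (\<pi> U)"
    by (simp add: matrix_mul_assoc left)
  finally show ?case
    using U by simp
qed

lemma conj_op_Mp_plus:
  assumes \<pi>: "is_proj_Mp_plus \<pi>" and "T \<in> Mp_plus"
  shows "conj_op T \<in> Mp_plus \<and> \<pi> (conj_op T) = conj_symp (\<pi> T)"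
  using \<open>T \<in> Mp_plus\<close>
proof induction
  case (metaplectic T)
  then show ?case
    using \<pi> conj_op_Mp[of \<pi> T] by (simp add: is_proj_Mp_plus_def Mp_plus.metaplectic)
next
  case (atomic T \<xi>)
  let ?\<Xi> = "block_mat (diag_mat (\<lambda>j. atom_a (\<xi> j))) (diag_mat (\<lambda>j. atom_b (\<xi> j)))
                  (diag_mat (\<lambda>j. atom_c (\<xi> j))) (diag_mat (\<lambda>j. atom_d (\<xi> j)))"
  note T' = conj_op_atomic_contraction[OF atomic]
  have "cnj (atom_a a) = atom_a a" "- cnj (atom_b a) = atom_b a"
    "- cnj (atom_c a) = atom_c a" "cnj (atom_d a) = atom_d a" for a
    by (cases a; simp add: cosh_sinh_of_real)+
  then have "conj_symp ?\<Xi> = ?\<Xi>"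
    by (simp add: conj_symp_diag_block_mat)
  moreover have "\<pi> T = ?\<Xi>" "\<pi> (conj_op T) = ?\<Xi>"
    using \<pi> atomic T' by (auto simp: is_proj_Mp_plus_def)
  ultimately show ?case
    using T' by (simp add: Mp_plus.atomic)
next
  case (comp T U)
  then show ?case
    unfolding conj_op_comp using \<pi> Mp_plus.comp[of "conj_op T" "conj_op U"]
    by (simp add: is_proj_Mp_plus_def conj_symp_mult del: comp_apply)
qed

theorem theorem1p7:
  fixes \<pi> :: "((real^'n::finite) L2 \<Rightarrow> (real^'n) L2) \<Rightarrow> complex^('n + 'n)^('n + 'n)"
    and S :: "complex^('n + 'n)^('n + 'n)"
    and A B C D :: "complex^'n^'n"
    and Shat T :: "(real^'n) L2 \<Rightarrow> (real^'n) L2"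
  assumes "is_proj_Mp_plus \<pi>"
    and "S \<in> Sp_plus"
    and "S = block_mat A B C D"
    and "Shat \<in> Mp_plus"
    and "\<pi> Shat = S"
    and "\<And>f. T f = cnj_L2 (Shat (cnj_L2 f))"
  shows "T \<in> Mp_plus \<and>
    \<pi> T = block_mat (map_matrix cnj A) (- map_matrix cnj B)
                    (- map_matrix cnj C) (map_matrix cnj D)"
proof -
  have "T = conj_op Shat"
    using assms(6) by (simp add: conj_op_def fun_eq_iff)
  then show ?thesis
    using conj_op_Mp_plus[OF assms(1,4)] assms(3,5) by (simp add: conj_symp_block_mat)
qed

end
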